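(* Complex $\ell_1^3$ has the $2$-summing property. Hence also complex $\ell_\infty^3$ has the $2$-summing property.
   Context: Scalars are complex and operators are bounded and linear. For an operator $T:X\to Y$ between Banach spaces, the $2$-summing norm is $\pi_2(T)=\sup\big(\sum_{i=1}^n\|TUe_i\|^2\big)^{1/2}\in[0,\infty]$, the supremum over all $n\ge 1$ and all operators $U:\ell_2^n\to X$ with $\|U\|\le 1$, where $(e_i)$ is the unit vector basis of $\ell_2^n$. A Banach space $X$ has the $2$-summing property if $\pi_2(T)=\|T\|$ for every operator $T:X\to\ell_2$. $\ell_1^3$ and $\ell_\infty^3$ are $\mathbb{C}^3$ with norms $\sum|z_j|$ and $\max|z_j|$. *)

theory Defs
  imports "HOL-Analysis.Analysis"
begin

section \<open>Complex Banach spaces\<close>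

class complex_normed_vector = real_normed_vector +
  fixes scaleC :: "complex \<Rightarrow> 'a \<Rightarrow> 'a"  (infixr "*\<^sub>C" 75)
  assumes scaleC_add_right: "c *\<^sub>C (x + y) = c *\<^sub>C x + c *\<^sub>C y"
    and scaleC_add_left: "(c + d) *\<^sub>C x = c *\<^sub>C x + d *\<^sub>C x"
    and scaleC_scaleC: "c *\<^sub>C (d *\<^sub>C x) = (c * d) *\<^sub>C x"
    and scaleR_scaleC: "r *\<^sub>R x = complex_of_real r *\<^sub>C x"
    and norm_scaleC: "norm (c *\<^sub>C x) = cmod c * norm x"

class complex_banach = complex_normed_vector + complete_space

subclass (in complex_banach) banach ..

definition bounded_clinear ::
    "('a::complex_normed_vector \<Rightarrow> 'b::complex_normed_vector) \<Rightarrow> bool" where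
  "bounded_clinear T \<longleftrightarrow> bounded_linear T \<and> (\<forall>c x. T (c *\<^sub>C x) = c *\<^sub>C T x)"


section \<open>The sequence space \<open>\<ell>\<^sub>2\<close>\<close>

typedef ell2 = "{x :: nat \<Rightarrow> complex. summable (\<lambda>i. (cmod (x i))\<^sup>2)}"
  morphisms ell2_nth Abs_ell2
  by (rule exI[of _ "\<lambda>_. 0"]) simp

setup_lifting type_definition_ell2

lemma sum_square_eq_L2_set: "(\<Sum>i\<in>A. (cmod (x i))\<^sup>2) = (L2_set (\<lambda>i. cmod (x i)) A)\<^sup>2"
  by (simp add: L2_set_def sum_nonneg)

lemma L2_set_cmod_add:
  "L2_set (\<lambda>i. cmod (x i + y i)) A \<le> L2_set (\<lambda>i. cmod (x i)) A + L2_set (\<lambda>i. cmod (y i)) A"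
proof -
  have "L2_set (\<lambda>i. cmod (x i + y i)) A \<le> L2_set (\<lambda>i. cmod (x i) + cmod (y i)) A"
    by (intro L2_set_mono norm_triangle_ineq) auto
  also have "\<dots> \<le> L2_set (\<lambda>i. cmod (x i)) A + L2_set (\<lambda>i. cmod (y i)) A"
    by (rule L2_set_triangle_ineq)
  finally show ?thesis .
qed

lemma L2_set_le_sqrt_suminf:
  assumes "summable (\<lambda>i. (cmod (x i))\<^sup>2)"
  shows "L2_set (\<lambda>i. cmod (x i)) {..<n} \<le> sqrt (\<Sum>i. (cmod (x i))\<^sup>2)"
  unfolding L2_set_def by (intro real_sqrt_le_mono sum_le_suminf assms) auto

lemma L2_set_bound_imp_ell2:
  assumes "\<And>n. L2_set (\<lambda>i. cmod (x i)) {..<n} \<le> B"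
  shows "summable (\<lambda>i. (cmod (x i))\<^sup>2)" and "sqrt (\<Sum>i. (cmod (x i))\<^sup>2) \<le> B"
proof -
  have B: "0 \<le> B" using assms[of 0] by simp
  have *: "(\<Sum>i<n. (cmod (x i))\<^sup>2) \<le> B\<^sup>2" for n
    unfolding sum_square_eq_L2_set by (intro power_mono assms L2_set_nonneg)
  show s: "summable (\<lambda>i. (cmod (x i))\<^sup>2)"
    by (rule summableI_nonneg_bounded[OF _ *]) auto
  have "(\<Sum>i. (cmod (x i))\<^sup>2) \<le> B\<^sup>2"
    by (rule suminf_le_const[OF s *])
  then show "sqrt (\<Sum>i. (cmod (x i))\<^sup>2) \<le> B"
    using B by (simp add: real_le_lsqrt suminf_nonneg[OF s])
qed

lemma ell2_add_aux:
  assumes "summable (\<lambda>i. (cmod (x i))\<^sup>2)" "summable (\<lambda>i. (cmod (y i))\<^sup>2)"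
  shows "summable (\<lambda>i. (cmod (x i + y i))\<^sup>2)"
    and "sqrt (\<Sum>i. (cmod (x i + y i))\<^sup>2) \<le>
           sqrt (\<Sum>i. (cmod (x i))\<^sup>2) + sqrt (\<Sum>i. (cmod (y i))\<^sup>2)"
proof -
  have "L2_set (\<lambda>i. cmod (x i + y i)) {..<n} \<le>
          sqrt (\<Sum>i. (cmod (x i))\<^sup>2) + sqrt (\<Sum>i. (cmod (y i))\<^sup>2)" for n
    using L2_set_cmod_add[of x y "{..<n}"] L2_set_le_sqrt_suminf[OF assms(1), of n]
      L2_set_le_sqrt_suminf[OF assms(2), of n] by linarith
  from L2_set_bound_imp_ell2[OF this]
  show "summable (\<lambda>i. (cmod (x i + y i))\<^sup>2)"
    and "sqrt (\<Sum>i. (cmod (x i + y i))\<^sup>2) \<le>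
           sqrt (\<Sum>i. (cmod (x i))\<^sup>2) + sqrt (\<Sum>i. (cmod (y i))\<^sup>2)" by auto
qed

instantiation ell2 :: complex_normed_vector
begin

lift_definition zero_ell2 :: ell2 is "\<lambda>_. 0" by simp

lift_definition plus_ell2 :: "ell2 \<Rightarrow> ell2 \<Rightarrow> ell2" is "\<lambda>x y i. x i + y i"
  by (rule ell2_add_aux(1))

lift_definition uminus_ell2 :: "ell2 \<Rightarrow> ell2" is "\<lambda>x i. - x i" by simp

lift_definition minus_ell2 :: "ell2 \<Rightarrow> ell2 \<Rightarrow> ell2" is "\<lambda>x y i. x i - y i"
  subgoal for x y using ell2_add_aux(1)[of x "\<lambda>i. - y i"] by simp
  done

lift_definition scaleC_ell2 :: "complex \<Rightarrow> ell2 \<Rightarrow> ell2" is "\<lambda>c x i. c * x i"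
  by (simp add: norm_mult power_mult_distrib summable_mult)

lift_definition scaleR_ell2 :: "real \<Rightarrow> ell2 \<Rightarrow> ell2" is "\<lambda>r x i. complex_of_real r * x i"
  by (simp add: norm_mult power_mult_distrib summable_mult)

lift_definition norm_ell2 :: "ell2 \<Rightarrow> real" is "\<lambda>x. sqrt (\<Sum>i. (cmod (x i))\<^sup>2)" .

definition dist_ell2 :: "ell2 \<Rightarrow> ell2 \<Rightarrow> real" where
  "dist_ell2 x y = norm (x - y)"

definition sgn_ell2 :: "ell2 \<Rightarrow> ell2" where
  "sgn_ell2 x = inverse (norm x) *\<^sub>R x"

definition uniformity_ell2 :: "(ell2 \<times> ell2) filter" where
  "uniformity_ell2 = (INF e\<in>{0 <..}. principal {(x, y). dist x y < e})"

definition open_ell2 :: "ell2 set \<Rightarrow> bool" where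
  "open_ell2 S = (\<forall>x\<in>S. \<forall>\<^sub>F (x', y) in uniformity. x' = x \<longrightarrow> y \<in> S)"

instance
proof
  fix x y z :: ell2 and a b :: real and c d :: complex
  show "x + y + z = x + (y + z)" by transfer (simp add: add.assoc)
  show "x + y = y + x" by transfer (simp add: add.commute)
  show "0 + x = x" by transfer simp
  show "- x + x = 0" by transfer simp
  show "x - y = x + - y" by transfer simp
  show "a *\<^sub>R (x + y) = a *\<^sub>R x + a *\<^sub>R y" by transfer (simp add: algebra_simps)
  show "(a + b) *\<^sub>R x = a *\<^sub>R x + b *\<^sub>R x" by transfer (simp add: algebra_simps)
  show "a *\<^sub>R b *\<^sub>R x = (a * b) *\<^sub>R x" by transfer (simp add: algebra_simps)
  show "1 *\<^sub>R x = x" by transfer simp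
  show "dist x y = norm (x - y)" by (simp add: dist_ell2_def)
  show "sgn x = inverse (norm x) *\<^sub>R x" by (simp only: sgn_ell2_def)
  show "(uniformity :: (ell2 \<times> ell2) filter) = (INF e\<in>{0 <..}. principal {(x, y). dist x y < e})"
    by (simp add: uniformity_ell2_def)
  show "open U = (\<forall>x\<in>U. \<forall>\<^sub>F (x', y) in uniformity. x' = x \<longrightarrow> y \<in> U)" for U :: "ell2 set"
    by (simp add: open_ell2_def)
  show "norm x = 0 \<longleftrightarrow> x = 0"
    by transfer (auto simp: suminf_eq_zero_iff fun_eq_iff)
  show "norm (x + y) \<le> norm x + norm y" by transfer (rule ell2_add_aux(2))
  show nC: "norm (c *\<^sub>C x) = cmod c * norm x" for c
    by transfer (simp add: norm_mult power_mult_distrib suminf_mult real_sqrt_mult)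
  have RC: "a *\<^sub>R x = complex_of_real a *\<^sub>C x" for a by transfer simp
  then show "a *\<^sub>R x = complex_of_real a *\<^sub>C x" .
  show "norm (a *\<^sub>R x) = \<bar>a\<bar> * norm x" by (simp add: RC nC)
  show "c *\<^sub>C (x + y) = c *\<^sub>C x + c *\<^sub>C y" by transfer (simp add: algebra_simps)
  show "(c + d) *\<^sub>C x = c *\<^sub>C x + d *\<^sub>C x" by transfer (simp add: algebra_simps)
  show "c *\<^sub>C (d *\<^sub>C x) = (c * d) *\<^sub>C x" by transfer (simp add: algebra_simps)
qed

end

lemma L2_set_ell2_le_norm: "L2_set (\<lambda>i. cmod (ell2_nth x i)) {..<n} \<le> norm x"
  by transfer (rule L2_set_le_sqrt_suminf)

lemma cmod_ell2_nth_le_norm: "cmod (ell2_nth x i) \<le> norm x"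
proof -
  have "cmod (ell2_nth x i) \<le> L2_set (\<lambda>i. cmod (ell2_nth x i)) {..<Suc i}"
    by (rule member_le_L2_set) auto
  also have "\<dots> \<le> norm x" by (rule L2_set_ell2_le_norm)
  finally show ?thesis .
qed

instance ell2 :: complex_banach
proof
  fix X :: "nat \<Rightarrow> ell2" assume X: "Cauchy X"
  have C: "Cauchy (\<lambda>n. ell2_nth (X n) i)" for i
  proof (rule metric_CauchyI)
    fix e :: real assume "0 < e"
    then obtain M where M: "\<forall>m\<ge>M. \<forall>n\<ge>M. dist (X m) (X n) < e"
      using metric_CauchyD[OF X] by blast
    have "dist (ell2_nth (X m) i) (ell2_nth (X n) i) \<le> dist (X m) (X n)" for m n
      using cmod_ell2_nth_le_norm[of "X m - X n" i]
      by (simp add: dist_norm minus_ell2.rep_eq)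
    with M show "\<exists>M. \<forall>m\<ge>M. \<forall>n\<ge>M. dist (ell2_nth (X m) i) (ell2_nth (X n) i) < e"
      using le_less_trans by blast
  qed
  define L where "L i = lim (\<lambda>n. ell2_nth (X n) i)" for i
  have L: "(\<lambda>n. ell2_nth (X n) i) \<longlonglongrightarrow> L i" for i
    unfolding L_def using C Cauchy_convergent convergent_LIMSEQ_iff by blast
  have key: "L2_set (\<lambda>i. cmod (ell2_nth (X m) i - L i)) {..<k} \<le> e"
    if M: "\<forall>m\<ge>M. \<forall>n\<ge>M. dist (X m) (X n) < e" and m: "m \<ge> M" for M e m k
  proof (rule tendsto_upperbound)
    show "(\<lambda>n. L2_set (\<lambda>i. cmod (ell2_nth (X m) i - ell2_nth (X n) i)) {..<k})
            \<longlonglongrightarrow> L2_set (\<lambda>i. cmod (ell2_nth (X m) i - L i)) {..<k}"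
      unfolding L2_set_def by (intro tendsto_intros L)
    show "\<forall>\<^sub>F n in sequentially.
            L2_set (\<lambda>i. cmod (ell2_nth (X m) i - ell2_nth (X n) i)) {..<k} \<le> e"
    proof (rule eventually_sequentiallyI)
      fix n assume "M \<le> n"
      then have "norm (X m - X n) < e" using M m by (simp add: dist_norm)
      then show "L2_set (\<lambda>i. cmod (ell2_nth (X m) i - ell2_nth (X n) i)) {..<k} \<le> e"
        using L2_set_ell2_le_norm[of "X m - X n" k] by (simp add: minus_ell2.rep_eq)
    qed
  qed simp
  obtain M1 where M1: "\<forall>m\<ge>M1. \<forall>n\<ge>M1. dist (X m) (X n) < 1"
    using metric_CauchyD[OF X, of 1] by auto
  have "summable (\<lambda>i. (cmod (ell2_nth (X M1) i - L i))\<^sup>2)"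
    using L2_set_bound_imp_ell2(1)[OF key[OF M1 order_refl]] .
  then have "summable (\<lambda>i. (cmod (L i - ell2_nth (X M1) i))\<^sup>2)"
    by (simp add: norm_minus_commute)
  moreover have "summable (\<lambda>i. (cmod (ell2_nth (X M1) i))\<^sup>2)"
    using ell2_nth[of "X M1"] by simp
  ultimately have sL: "summable (\<lambda>i. (cmod (L i))\<^sup>2)"
    using ell2_add_aux(1)[of "\<lambda>i. L i - ell2_nth (X M1) i" "ell2_nth (X M1)"] by simp
  define l where "l = Abs_ell2 L"
  have l: "ell2_nth l = L" unfolding l_def using sL by (simp add: Abs_ell2_inverse)
  have "X \<longlonglongrightarrow> l"
  proof (rule metric_LIMSEQ_I)
    fix r :: real assume "0 < r"
    then obtain M where M: "\<forall>m\<ge>M. \<forall>n\<ge>M. dist (X m) (X n) < r / 2"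
      using metric_CauchyD[OF X, of "r/2"] by auto
    have "dist (X m) l < r" if "m \<ge> M" for m
    proof -
      have "norm (X m - l) \<le> r / 2"
        using L2_set_bound_imp_ell2(2)[OF key[OF M that]]
        by (simp add: norm_ell2.rep_eq minus_ell2.rep_eq l)
      with \<open>0 < r\<close> show ?thesis by (simp add: dist_norm)
    qed
    then show "\<exists>no. \<forall>n\<ge>no. dist (X n) l < r" by blast
  qed
  then show "convergent X" by (rule convergentI)
qed


section \<open>The spaces \<open>\<ell>\<^sub>1\<^sup>n\<close> and \<open>\<ell>\<^sub>\<infinity>\<^sup>n\<close>\<close>

text \<open>
  The type \<^typ>\<open>complex ^ 'n\<close> already carries the Euclidean norm, so \<open>\<complex>\<^sup>n\<close> with each of the
  other two norms is a copy of it; the dimension is the cardinality of the index type.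
\<close>

typedef 'n ell1_fin = "UNIV :: (complex ^ 'n) set"
  morphisms ell1_vec Abs_ell1_fin ..

setup_lifting type_definition_ell1_fin

instantiation ell1_fin :: (finite) complex_normed_vector
begin

lift_definition zero_ell1_fin :: "'a ell1_fin" is 0 .
lift_definition plus_ell1_fin :: "'a ell1_fin \<Rightarrow> 'a ell1_fin \<Rightarrow> 'a ell1_fin" is "(+)" .
lift_definition uminus_ell1_fin :: "'a ell1_fin \<Rightarrow> 'a ell1_fin" is uminus .
lift_definition minus_ell1_fin :: "'a ell1_fin \<Rightarrow> 'a ell1_fin \<Rightarrow> 'a ell1_fin" is "(-)" .
lift_definition scaleC_ell1_fin :: "complex \<Rightarrow> 'a ell1_fin \<Rightarrow> 'a ell1_fin" is "(*s)" .
lift_definition scaleR_ell1_fin :: "real \<Rightarrow> 'a ell1_fin \<Rightarrow> 'a ell1_fin" is scaleR .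
lift_definition norm_ell1_fin :: "'a ell1_fin \<Rightarrow> real" is "\<lambda>x. \<Sum>i\<in>UNIV. cmod (x $ i)" .

definition dist_ell1_fin :: "'a ell1_fin \<Rightarrow> 'a ell1_fin \<Rightarrow> real" where
  "dist_ell1_fin x y = norm (x - y)"

definition sgn_ell1_fin :: "'a ell1_fin \<Rightarrow> 'a ell1_fin" where
  "sgn_ell1_fin x = inverse (norm x) *\<^sub>R x"

definition uniformity_ell1_fin :: "('a ell1_fin \<times> 'a ell1_fin) filter" where
  "uniformity_ell1_fin = (INF e\<in>{0 <..}. principal {(x, y). dist x y < e})"

definition open_ell1_fin :: "'a ell1_fin set \<Rightarrow> bool" where
  "open_ell1_fin S = (\<forall>x\<in>S. \<forall>\<^sub>F (x', y) in uniformity. x' = x \<longrightarrow> y \<in> S)"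

instance
proof
  fix x y z :: "'a ell1_fin" and a b :: real and c d :: complex
  show "x + y + z = x + (y + z)" by transfer (simp add: add.assoc)
  show "x + y = y + x" by transfer (simp add: add.commute)
  show "0 + x = x" by transfer simp
  show "- x + x = 0" by transfer simp
  show "x - y = x + - y" by transfer simp
  show "a *\<^sub>R (x + y) = a *\<^sub>R x + a *\<^sub>R y" by transfer (simp add: algebra_simps)
  show "(a + b) *\<^sub>R x = a *\<^sub>R x + b *\<^sub>R x" by transfer (simp add: algebra_simps)
  show "a *\<^sub>R b *\<^sub>R x = (a * b) *\<^sub>R x" by transfer (simp add: algebra_simps)
  show "1 *\<^sub>R x = x" by transfer simp
  show "dist x y = norm (x - y)" by (simp add: dist_ell1_fin_def)
  show "sgn x = inverse (norm x) *\<^sub>R x" by (simp only: sgn_ell1_fin_def)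
  show "(uniformity :: ('a ell1_fin \<times> 'a ell1_fin) filter)
          = (INF e\<in>{0 <..}. principal {(x, y). dist x y < e})"
    by (simp add: uniformity_ell1_fin_def)
  show "open U = (\<forall>x\<in>U. \<forall>\<^sub>F (x', y) in uniformity. x' = x \<longrightarrow> y \<in> U)" for U :: "'a ell1_fin set"
    by (simp add: open_ell1_fin_def)
  show "norm x = 0 \<longleftrightarrow> x = 0"
    by transfer (simp add: sum_nonneg_eq_0_iff vec_eq_iff)
  show "norm (x + y) \<le> norm x + norm y"
    by transfer (simp add: sum.distrib[symmetric] sum_mono norm_triangle_ineq)
  show nC: "norm (c *\<^sub>C x) = cmod c * norm x" for c
    by transfer (simp add: norm_mult sum_distrib_left)
  have RC: "a *\<^sub>R x = complex_of_real a *\<^sub>C x" for a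
    by transfer (simp only: vec_eq_iff vector_scaleR_component vector_smult_component,
        simp add: scaleR_conv_of_real)
  then show "a *\<^sub>R x = complex_of_real a *\<^sub>C x" .
  show "norm (a *\<^sub>R x) = \<bar>a\<bar> * norm x" by (simp add: RC nC)
  show "c *\<^sub>C (x + y) = c *\<^sub>C x + c *\<^sub>C y" by transfer (simp add: vec_eq_iff algebra_simps)
  show "(c + d) *\<^sub>C x = c *\<^sub>C x + d *\<^sub>C x" by transfer (simp add: vec_eq_iff algebra_simps)
  show "c *\<^sub>C (d *\<^sub>C x) = (c * d) *\<^sub>C x" by transfer (simp add: vec_eq_iff algebra_simps)
qed

end

lemma Cauchy_of_dominated_dist:
  assumes "Cauchy X" and "\<And>m n. dist (f (X m)) (f (X n)) \<le> dist (X m) (X n)"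
  shows "Cauchy (\<lambda>n. f (X n))"
  using assms unfolding Cauchy_def by (meson le_less_trans)

instance ell1_fin :: (finite) complex_banach
proof
  fix X :: "nat \<Rightarrow> 'a ell1_fin" assume X: "Cauchy X"
  have "Cauchy (\<lambda>n. ell1_vec (X n) $ i)" for i
  proof (rule Cauchy_of_dominated_dist[OF X, of "\<lambda>x. ell1_vec x $ i"])
    fix m n
    show "dist (ell1_vec (X m) $ i) (ell1_vec (X n) $ i) \<le> dist (X m) (X n)"
      by (auto simp: dist_norm norm_ell1_fin.rep_eq minus_ell1_fin.rep_eq
          intro!: member_le_sum[of i UNIV "\<lambda>i. cmod (ell1_vec (X m) $ i - ell1_vec (X n) $ i)"])
  qed
  then have "\<forall>i. \<exists>l. (\<lambda>n. ell1_vec (X n) $ i) \<longlonglongrightarrow> l"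
    by (simp add: Cauchy_convergent convergent_def[symmetric])
  then obtain L where L: "\<And>i. (\<lambda>n. ell1_vec (X n) $ i) \<longlonglongrightarrow> L i" by metis
  have "(\<lambda>n. \<Sum>i\<in>UNIV. cmod (ell1_vec (X n) $ i - L i)) \<longlonglongrightarrow> (\<Sum>i\<in>UNIV. cmod (L i - L i))"
    by (intro tendsto_intros L)
  then have "(\<lambda>n. norm (X n - Abs_ell1_fin (\<chi> i. L i))) \<longlonglongrightarrow> 0"
    by (simp add: norm_ell1_fin.rep_eq minus_ell1_fin.rep_eq Abs_ell1_fin_inverse)
  then have "(\<lambda>n. X n - Abs_ell1_fin (\<chi> i. L i)) \<longlonglongrightarrow> 0"
    by (rule tendsto_norm_zero_cancel)
  from LIM_zero_cancel[OF this] show "convergent X"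
    by (rule convergentI)
qed


typedef 'n ellinf_fin = "UNIV :: (complex ^ 'n) set"
  morphisms ellinf_vec Abs_ellinf_fin ..

setup_lifting type_definition_ellinf_fin

lemma Max_cmod_le_iff:
  "(MAX i. cmod (x $ i)) \<le> B \<longleftrightarrow> (\<forall>i. cmod (x $ i) \<le> B)" for x :: "complex ^ 'n"
  by simp

lemma cmod_le_Max: "cmod (x $ i) \<le> (MAX i. cmod (x $ i))" for x :: "complex ^ 'n"
  by simp

instantiation ellinf_fin :: (finite) complex_normed_vector
begin

lift_definition zero_ellinf_fin :: "'a ellinf_fin" is 0 .
lift_definition plus_ellinf_fin :: "'a ellinf_fin \<Rightarrow> 'a ellinf_fin \<Rightarrow> 'a ellinf_fin" is "(+)" .
lift_definition uminus_ellinf_fin :: "'a ellinf_fin \<Rightarrow> 'a ellinf_fin" is uminus .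
lift_definition minus_ellinf_fin :: "'a ellinf_fin \<Rightarrow> 'a ellinf_fin \<Rightarrow> 'a ellinf_fin" is "(-)" .
lift_definition scaleC_ellinf_fin :: "complex \<Rightarrow> 'a ellinf_fin \<Rightarrow> 'a ellinf_fin" is "(*s)" .
lift_definition scaleR_ellinf_fin :: "real \<Rightarrow> 'a ellinf_fin \<Rightarrow> 'a ellinf_fin" is scaleR .
lift_definition norm_ellinf_fin :: "'a ellinf_fin \<Rightarrow> real" is "\<lambda>x. MAX i. cmod (x $ i)" .

definition dist_ellinf_fin :: "'a ellinf_fin \<Rightarrow> 'a ellinf_fin \<Rightarrow> real" where
  "dist_ellinf_fin x y = norm (x - y)"

definition sgn_ellinf_fin :: "'a ellinf_fin \<Rightarrow> 'a ellinf_fin" where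
  "sgn_ellinf_fin x = inverse (norm x) *\<^sub>R x"

definition uniformity_ellinf_fin :: "('a ellinf_fin \<times> 'a ellinf_fin) filter" where
  "uniformity_ellinf_fin = (INF e\<in>{0 <..}. principal {(x, y). dist x y < e})"

definition open_ellinf_fin :: "'a ellinf_fin set \<Rightarrow> bool" where
  "open_ellinf_fin S = (\<forall>x\<in>S. \<forall>\<^sub>F (x', y) in uniformity. x' = x \<longrightarrow> y \<in> S)"

instance
proof
  fix x y z :: "'a ellinf_fin" and a b :: real and c d :: complex
  show "x + y + z = x + (y + z)" by transfer (simp add: add.assoc)
  show "x + y = y + x" by transfer (simp add: add.commute)
  show "0 + x = x" by transfer simp
  show "- x + x = 0" by transfer simp
  show "x - y = x + - y" by transfer simp
  show "a *\<^sub>R (x + y) = a *\<^sub>R x + a *\<^sub>R y" by transfer (simp add: algebra_simps)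
  show "(a + b) *\<^sub>R x = a *\<^sub>R x + b *\<^sub>R x" by transfer (simp add: algebra_simps)
  show "a *\<^sub>R b *\<^sub>R x = (a * b) *\<^sub>R x" by transfer (simp add: algebra_simps)
  show "1 *\<^sub>R x = x" by transfer simp
  show "dist x y = norm (x - y)" by (simp add: dist_ellinf_fin_def)
  show "sgn x = inverse (norm x) *\<^sub>R x" by (simp only: sgn_ellinf_fin_def)
  show "(uniformity :: ('a ellinf_fin \<times> 'a ellinf_fin) filter)
          = (INF e\<in>{0 <..}. principal {(x, y). dist x y < e})"
    by (simp add: uniformity_ellinf_fin_def)
  show "open U = (\<forall>x\<in>U. \<forall>\<^sub>F (x', y) in uniformity. x' = x \<longrightarrow> y \<in> U)" for U :: "'a ellinf_fin set"
    by (simp add: open_ellinf_fin_def)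
  show "norm x = 0 \<longleftrightarrow> x = 0"
  proof transfer
    fix x :: "complex ^ 'a"
    show "(MAX i. cmod (x $ i)) = 0 \<longleftrightarrow> x = 0"
    proof
      assume "(MAX i. cmod (x $ i)) = 0"
      then have "cmod (x $ i) \<le> 0" for i using cmod_le_Max[of x i] by simp
      then show "x = 0" by (simp add: vec_eq_iff)
    qed simp
  qed
  show "norm (x + y) \<le> norm x + norm y"
  proof transfer
    fix x y :: "complex ^ 'a"
    have "cmod ((x + y) $ i) \<le> (MAX i. cmod (x $ i)) + (MAX i. cmod (y $ i))" for i
      using norm_triangle_ineq[of "x $ i" "y $ i"] cmod_le_Max[of x i] cmod_le_Max[of y i]
      by (simp only: vector_add_component)
    then show "(MAX i. cmod ((x + y) $ i)) \<le> (MAX i. cmod (x $ i)) + (MAX i. cmod (y $ i))"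
      by (simp only: Max_cmod_le_iff) blast
  qed
  show nC: "norm (c *\<^sub>C x) = cmod c * norm x" for c
  proof transfer
    fix c and x :: "complex ^ 'a"
    have "mono (\<lambda>t. cmod c * t)" by (simp add: mono_def mult_left_mono)
    from mono_Max_commute[OF this, of "range (\<lambda>i. cmod (x $ i))"]
    show "(MAX i. cmod ((c *s x) $ i)) = cmod c * (MAX i. cmod (x $ i))"
      by (simp add: norm_mult image_image)
  qed
  have RC: "a *\<^sub>R x = complex_of_real a *\<^sub>C x" for a
    by transfer (simp only: vec_eq_iff vector_scaleR_component vector_smult_component,
        simp add: scaleR_conv_of_real)
  then show "a *\<^sub>R x = complex_of_real a *\<^sub>C x" .
  show "norm (a *\<^sub>R x) = \<bar>a\<bar> * norm x" by (simp add: RC nC)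
  show "c *\<^sub>C (x + y) = c *\<^sub>C x + c *\<^sub>C y" by transfer (simp add: vec_eq_iff algebra_simps)
  show "(c + d) *\<^sub>C x = c *\<^sub>C x + d *\<^sub>C x" by transfer (simp add: vec_eq_iff algebra_simps)
  show "c *\<^sub>C (d *\<^sub>C x) = (c * d) *\<^sub>C x" by transfer (simp add: vec_eq_iff algebra_simps)
qed

end

instance ellinf_fin :: (finite) complex_banach
proof
  fix X :: "nat \<Rightarrow> 'a ellinf_fin" assume X: "Cauchy X"
  have "Cauchy (\<lambda>n. ellinf_vec (X n) $ i)" for i
  proof (rule Cauchy_of_dominated_dist[OF X, of "\<lambda>x. ellinf_vec x $ i"])
    fix m n
    show "dist (ellinf_vec (X m) $ i) (ellinf_vec (X n) $ i) \<le> dist (X m) (X n)"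
      using cmod_le_Max[of "ellinf_vec (X m) - ellinf_vec (X n)" i]
      by (simp only: dist_norm norm_ellinf_fin.rep_eq minus_ellinf_fin.rep_eq
          vector_minus_component)
  qed
  then have "\<forall>i. \<exists>l. (\<lambda>n. ellinf_vec (X n) $ i) \<longlonglongrightarrow> l"
    by (simp add: Cauchy_convergent convergent_def[symmetric])
  then obtain L where L: "\<And>i. (\<lambda>n. ellinf_vec (X n) $ i) \<longlonglongrightarrow> L i" by metis
  define l where "l = Abs_ellinf_fin (\<chi> i. L i)"
  have "(\<lambda>n. \<Sum>i\<in>UNIV. cmod (ellinf_vec (X n) $ i - L i)) \<longlonglongrightarrow> (\<Sum>i\<in>UNIV. cmod (L i - L i))"
    by (intro tendsto_intros L)
  then have S: "(\<lambda>n. \<Sum>i\<in>UNIV. cmod (ellinf_vec (X n) $ i - L i)) \<longlonglongrightarrow> 0" by simp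
  have "(\<lambda>n. X n - l) \<longlonglongrightarrow> 0"
  proof (rule Lim_null_comparison[OF _ S], rule always_eventually, rule allI)
    fix n
    have "cmod ((ellinf_vec (X n) - (\<chi> i. L i)) $ j) \<le> (\<Sum>i\<in>UNIV. cmod (ellinf_vec (X n) $ i - L i))" for j
      using member_le_sum[of j UNIV "\<lambda>i. cmod (ellinf_vec (X n) $ i - L i)"] by simp
    then show "norm (X n - l) \<le> (\<Sum>i\<in>UNIV. cmod (ellinf_vec (X n) $ i - L i))"
      unfolding norm_ellinf_fin.rep_eq minus_ellinf_fin.rep_eq l_def
      by (simp only: Max_cmod_le_iff Abs_ellinf_fin_inverse UNIV_I) blast
  qed
  from LIM_zero_cancel[OF this] show "convergent X"
    by (rule convergentI)
qed


section \<open>The \<open>2\<close>-summing norm and the \<open>2\<close>-summing property\<close>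

text \<open>
  Since \<open>n\<close> varies in the definition of the \<open>2\<close>-summing norm, \<open>\<ell>\<^sub>2\<^sup>n\<close> is represented by a
  carrier set: the functions on the natural numbers vanishing outside \<open>{..<n}\<close>, with
  pointwise operations and norm \<open>L2_set (\<lambda>i. cmod (x i)) {..<n}\<close>.
\<close>

definition ell2_fin_carrier :: "nat \<Rightarrow> (nat \<Rightarrow> complex) set" where
  "ell2_fin_carrier n = {x. \<forall>i\<ge>n. x i = 0}"

definition ell2_fin_unit :: "nat \<Rightarrow> nat \<Rightarrow> complex" where
  "ell2_fin_unit i = (\<lambda>j. if j = i then 1 else 0)"

text \<open>
  Linear operators \<open>U : \<ell>\<^sub>2\<^sup>n \<rightarrow> X\<close> with \<open>\<parallel>U\<parallel> \<le> 1\<close>. Values of \<open>U\<close> outside the carrier are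
  irrelevant.
\<close>

definition ell2_fin_contraction ::
    "nat \<Rightarrow> ((nat \<Rightarrow> complex) \<Rightarrow> 'a::complex_normed_vector) \<Rightarrow> bool" where
  "ell2_fin_contraction n U \<longleftrightarrow>
     (\<forall>x\<in>ell2_fin_carrier n. \<forall>y\<in>ell2_fin_carrier n. U (\<lambda>i. x i + y i) = U x + U y) \<and>
     (\<forall>c. \<forall>x\<in>ell2_fin_carrier n. U (\<lambda>i. c * x i) = c *\<^sub>C U x) \<and>
     (\<forall>x\<in>ell2_fin_carrier n. norm (U x) \<le> L2_set (\<lambda>i. cmod (x i)) {..<n})"

definition two_summing_norm ::
    "('a::complex_banach \<Rightarrow> 'b::complex_banach) \<Rightarrow> ennreal" where
  "two_summing_norm T =
     (SUP (n, U) \<in> {(n, U). 1 \<le> n \<and> ell2_fin_contraction n U}.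
        ennreal (sqrt (\<Sum>i<n. (norm (T (U (ell2_fin_unit i))))\<^sup>2)))"

definition two_summing_property :: "'a::complex_banach itself \<Rightarrow> bool" where
  "two_summing_property _ \<longleftrightarrow>
     (\<forall>T :: 'a \<Rightarrow> ell2. bounded_clinear T \<longrightarrow> two_summing_norm T = ennreal (onorm T))"

end

theory Submission
  imports Defs
begin

text \<open>
  For both spaces the claim is the inequality \<open>tr (A B) \<le> M\<close> for positive semidefinite complex
  \<open>3 \<times> 3\<close> matrices, where \<open>A\<close> has diagonal entries at most \<open>1\<close> and \<open>z\<^sup>* B z \<le> M\<close> for all
  \<open>z\<close> with unimodular entries: \<open>A\<close> and \<open>B\<close> are the Gram matrices of \<open>T\<close> and \<open>U\<close>, in one order
  for \<open>\<ell>\<^sub>1\<^sup>3\<close> and in the other for \<open>\<ell>\<^sub>\<infinity>\<^sup>3\<close>. One may take the diagonal of \<open>A\<close> to be \<open>1\<close>. With the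
  entries \<open>13\<close> and \<open>23\<close> of \<open>A\<close> fixed, the entry \<open>12\<close> ranges over a disc, so \<open>tr (A B)\<close> is largest
  at a boundary point of it, where \<open>A\<close> has rank at most two. There \<open>A\<close> is a convex combination
  of two matrices \<open>z z\<^sup>*\<close> with \<open>z\<close> unimodular.
\<close>

section \<open>Hermitian forms in three variables\<close>

text \<open>A Hermitian matrix is carried as its real diagonal and its entries 12, 13, 23. If these
  are the Gram entries of three vectors, the form is the squared norm of their combination with
  coefficients \<open>x\<close>, \<open>y\<close>, \<open>z\<close>.\<close>

definition hform ::
    "real \<Rightarrow> real \<Rightarrow> real \<Rightarrow> complex \<Rightarrow> complex \<Rightarrow> complex \<Rightarrow> complex \<Rightarrow> complex \<Rightarrow> complex \<Rightarrow> real" where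
  "hform \<alpha> \<beta> \<gamma> a b c x y z =
     \<alpha> * (cmod x)\<^sup>2 + \<beta> * (cmod y)\<^sup>2 + \<gamma> * (cmod z)\<^sup>2
       + 2 * Re (a * (x * cnj y) + b * (x * cnj z) + c * (y * cnj z))"

lemma cmod_power2_linear_combination:
  "(cmod (x * u + y * v + z * w))\<^sup>2 =
     hform ((cmod u)\<^sup>2) ((cmod v)\<^sup>2) ((cmod w)\<^sup>2) (u * cnj v) (u * cnj w) (v * cnj w) x y z"
  unfolding hform_def cmod_power2 by (simp add: power2_eq_square algebra_simps)

section \<open>Splitting rank-two matrices into unimodular rank-one matrices\<close>

lemma unit_in_kernel:
  obtains e :: complex where "cmod e = 1" "Re (h * e) = 0"
proof (cases "h = 0")
  case True
  then show ?thesis by (intro that[of 1]) auto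
next
  case False
  \<comment> \<open>The factor rotates \<open>h\<close> onto the imaginary axis.\<close>
  show ?thesis
  proof (rule that[of "\<i> * cnj h / cmod h"])
    show "cmod (\<i> * cnj h / cmod h) = 1" using False by (simp add: norm_mult norm_divide)
    have "h * (\<i> * cnj h / cmod h) = \<i> * (complex_of_real ((cmod h)\<^sup>2) / cmod h)"
      by (simp only: complex_norm_square) (simp add: mult_ac)
    then show "Re (h * (\<i> * cnj h / cmod h)) = 0" by (simp del: of_real_power flip: of_real_divide)
  qed
qed

text \<open>Eliminating \<open>k\<close> leaves one real-linear equation in \<open>e\<close>, and
  its kernel in the plane contains a unit vector. This \<open>e\<close> is the direction of the line
  through the common points of the two circles used below.\<close>

lemma common_ratio:
  fixes p q s t :: complex
  obtains e k where "cmod e = 1" "Re (cnj p * s * e) = k * (cmod s)\<^sup>2"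
    "Re (cnj q * t * e) = k * (cmod t)\<^sup>2"
proof -
  obtain e where e: "cmod e = 1"
    and ker: "Re ((cnj p * s * of_real ((cmod t)\<^sup>2) - cnj q * t * of_real ((cmod s)\<^sup>2)) * e) = 0"
    using unit_in_kernel by blast
  have "(cnj p * s * of_real ((cmod t)\<^sup>2) - cnj q * t * of_real ((cmod s)\<^sup>2)) * e
      = of_real ((cmod t)\<^sup>2) * (cnj p * s * e) - of_real ((cmod s)\<^sup>2) * (cnj q * t * e)"
    by (simp only: algebra_simps)
  with ker have *: "(cmod t)\<^sup>2 * Re (cnj p * s * e) = (cmod s)\<^sup>2 * Re (cnj q * t * e)"
    by (simp only: Re_complex_of_real Im_complex_of_real minus_complex.sel times_complex.sel)
  show ?thesis
  proof (cases "s = 0")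
    case s: True
    show ?thesis
    proof (cases "t = 0")
      case True
      with s e show ?thesis by (intro that[of e 0]) auto
    next
      case False
      with s e show ?thesis by (intro that[of e "Re (cnj q * t * e) / (cmod t)\<^sup>2"]) auto
    qed
  next
    case False
    with * e show ?thesis
      by (intro that[of e "Re (cnj p * s * e) / (cmod s)\<^sup>2"]) (auto simp: field_simps)
  qed
qed

text \<open>
  The unit vectors \<open>(p, s)\<close>, \<open>(q, t)\<close> and \<open>(1, 0)\<close> of \<open>\<complex>\<^sup>2\<close> have the same Gram matrix as the
  random variables \<open>p + s \<omega>\<close>, \<open>q + t \<omega>\<close> and \<open>1\<close>, where \<open>\<omega>\<close> takes the values \<open>\<zeta>\<close>, \<open>\<xi>\<close> with
  probabilities \<open>l\<close>, \<open>m\<close>. With respect to the circles \<open>\<bar>p + s \<omega>\<bar> = 1\<close> and \<open>\<bar>q + t \<omega>\<bar> = 1\<close> the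
  origin has power \<open>-1\<close>, so their two common points lie on a line through it.
\<close>

lemma unimodular_decomposition:
  fixes p q s t :: complex
  assumes "(cmod p)\<^sup>2 + (cmod s)\<^sup>2 = 1" "(cmod q)\<^sup>2 + (cmod t)\<^sup>2 = 1"
  obtains \<zeta> \<xi> :: complex and l m :: real where
    "cmod (p + s * \<zeta>) = 1" "cmod (q + t * \<zeta>) = 1" "cmod (p + s * \<xi>) = 1" "cmod (q + t * \<xi>) = 1"
    "0 \<le> l" "0 \<le> m" "l + m = 1" "l * \<zeta> + m * \<xi> = 0" "l * (cmod \<zeta>)\<^sup>2 + m * (cmod \<xi>)\<^sup>2 = 1"
proof -
  obtain e k where e: "cmod e = 1" and p: "Re (cnj p * s * e) = k * (cmod s)\<^sup>2"
    and q: "Re (cnj q * t * e) = k * (cmod t)\<^sup>2"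
    using common_ratio by blast
  \<comment> \<open>Because \<open>k\<close> is shared, both circle equations along the line of
    \<open>e\<close> follow from the same quadratic in \<open>r\<close>.\<close>
  have unimod: "cmod (p' + s' * (of_real r * e)) = 1"
    if "(cmod p')\<^sup>2 + (cmod s')\<^sup>2 = 1" "Re (cnj p' * s' * e) = k * (cmod s')\<^sup>2"
      and r: "r\<^sup>2 + 2 * k * r = 1" for p' s' r
  proof -
    have "(cmod (p' + s' * (of_real r * e)))\<^sup>2
        = (cmod p')\<^sup>2 + 2 * r * Re (cnj p' * s' * e) + (cmod (s' * of_real r * e))\<^sup>2"
      unfolding cmod_power2 by (simp add: power2_eq_square algebra_simps)
    also have "\<dots> = (cmod p')\<^sup>2 + (cmod s')\<^sup>2 * (r\<^sup>2 + 2 * k * r)"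
      unfolding that(2) norm_mult e power_mult_distrib by (simp add: algebra_simps)
    also have "\<dots> = 1" using that(1) r by simp
    finally show ?thesis by (intro power2_eq_imp_eq[where y = 1]) simp_all
  qed
  define w where "w = sqrt (k\<^sup>2 + 1)"
  have w: "w\<^sup>2 = k\<^sup>2 + 1" unfolding w_def by simp
  have wk: "\<bar>k\<bar> < w" unfolding w_def by (rule real_less_rsqrt) simp
  then have w0: "0 < w" by linarith
  \<comment> \<open>The two roots; their product is -1, so they have opposite signs.\<close>
  define r1 r2 where "r1 = w - k" and "r2 = - w - k"
  have r1: "r1\<^sup>2 + 2 * k * r1 = 1" and r2: "r2\<^sup>2 + 2 * k * r2 = 1"
    using w unfolding r1_def r2_def by (simp_all add: power2_eq_square algebra_simps)
  \<comment> \<open>The weights that give the roots mean zero. The quadratic then forces second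
    moment 1.\<close>
  define l m where "l = (w + k) / (2 * w)" and "m = (w - k) / (2 * w)"
  have lm: "0 \<le> l" "0 \<le> m" "l + m = 1"
    using wk w0 unfolding l_def m_def by (auto simp: field_simps)
  have lin: "l * r1 + m * r2 = 0"
    using w0 unfolding l_def m_def r1_def r2_def by (simp add: field_simps)
  have quad: "l * r1\<^sup>2 + m * r2\<^sup>2 = 1"
  proof -
    have "r1\<^sup>2 = 1 - 2 * k * r1" "r2\<^sup>2 = 1 - 2 * k * r2" using r1 r2 by linarith+
    then have "l * r1\<^sup>2 + m * r2\<^sup>2 = l * (1 - 2 * k * r1) + m * (1 - 2 * k * r2)" by simp
    also have "\<dots> = (l + m) - 2 * k * (l * r1 + m * r2)" by (simp add: algebra_simps)
    finally show ?thesis using lin lm by simp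
  qed
  show ?thesis
  proof (rule that[of "of_real r1 * e" "of_real r2 * e" l m])
    have "l * (r1 * e) + m * (r2 * e) = of_real (l * r1 + m * r2) * e"
      by (simp add: algebra_simps)
    then show "l * (r1 * e) + m * (r2 * e) = 0" by (simp only: lin) simp
  qed (use assms p q r1 r2 lm quad in \<open>auto intro!: unimod simp: norm_mult e\<close>)
qed

section \<open>The trace inequality for Hermitian forms\<close>

lemma unimodular_multiple:
  obtains u :: complex where "cmod u = 1" "h * u = of_real (cmod h)"
proof (cases "h = 0")
  case True
  then show ?thesis by (intro that[of 1]) auto
next
  case False
  show ?thesis
  proof (rule that[of "cnj h / cmod h"])
    show "cmod (cnj h / cmod h) = 1" using False by (simp add: norm_divide)
    have "h * (cnj h / cmod h) = complex_of_real ((cmod h)\<^sup>2) / complex_of_real (cmod h)"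
      by (simp only: complex_norm_square times_divide_eq_right)
    also have "\<dots> = of_real (cmod h)" using False by (simp add: power2_eq_square)
    finally show "h * (cnj h / cmod h) = of_real (cmod h)" .
  qed
qed

text \<open>Rotating \<open>x\<close> makes the cross term real, which leaves the determinant
  criterion for a real quadratic form.\<close>

lemma binary_form_nonneg_imp:
  fixes h :: complex
  assumes nonneg: "\<And>x y. 0 \<le> P * (cmod x)\<^sup>2 + Q * (cmod y)\<^sup>2 + 2 * Re (h * (x * cnj y))"
  shows "0 \<le> P" "0 \<le> Q" "(cmod h)\<^sup>2 \<le> P * Q"
proof -
  show P: "0 \<le> P" using nonneg[of 1 0] by simp
  show Q: "0 \<le> Q" using nonneg[of 0 1] by simp
  obtain u where u: "cmod u = 1" "h * u = of_real (cmod h)" using unimodular_multiple by blast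
  have real: "0 \<le> P * r\<^sup>2 + Q * s\<^sup>2 - 2 * cmod h * (r * s)" for r s
  proof -
    have "h * (of_real r * u * cnj (of_real (- s))) = of_real (- (cmod h * (r * s)))"
      using u(2) by (simp add: algebra_simps)
    then show ?thesis
      using nonneg[of "of_real r * u" "of_real (- s)"]
      by (simp only: norm_mult norm_of_real Re_complex_of_real u) simp
  qed
  show "(cmod h)\<^sup>2 \<le> P * Q"
  proof (cases "P = 0")
    case True
    \<comment> \<open>An affine function of \<open>r\<close> bounded below is constant; the chosen
      \<open>r\<close> would give the value -1.\<close>
    have "0 \<le> Q - 2 * cmod h * r" for r using real[of r 1] True by simp
    from this[of "(Q + 1) / (2 * cmod h)"] have "cmod h = 0" by (cases "h = 0") simp_all
    then show ?thesis using True by simp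
  next
    case False
    have "0 \<le> P * (P * Q - (cmod h)\<^sup>2)"
      using real[of "cmod h" P] by (simp add: power2_eq_square algebra_simps)
    with False P show ?thesis by (simp add: zero_le_mult_iff)
  qed
qed

text \<open>
  Completing the square in the third variable shows that the off-diagonal entry \<open>a\<close> lies in a
  disc with centre \<open>b * cnj c\<close>.
\<close>

lemma hform_nonneg_imp:
  assumes nonneg: "\<And>x y z. 0 \<le> hform 1 1 1 a b c x y z"
  shows "cmod b \<le> 1" "cmod c \<le> 1"
    "cmod (a - b * cnj c) \<le> sqrt (1 - (cmod b)\<^sup>2) * sqrt (1 - (cmod c)\<^sup>2)"
proof -
  have "0 \<le> (1 - (cmod b)\<^sup>2) * (cmod x)\<^sup>2 + (1 - (cmod c)\<^sup>2) * (cmod y)\<^sup>2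
           + 2 * Re ((a - b * cnj c) * (x * cnj y))" for x y
  proof -
    have "hform 1 1 1 a b c x y (- (b * x + c * y)) =
        (1 - (cmod b)\<^sup>2) * (cmod x)\<^sup>2 + (1 - (cmod c)\<^sup>2) * (cmod y)\<^sup>2
           + 2 * Re ((a - b * cnj c) * (x * cnj y))"
      unfolding hform_def cmod_power2 by (simp add: power2_eq_square algebra_simps)
    with nonneg show ?thesis by metis
  qed
  note bin = binary_form_nonneg_imp[OF this]
  show "cmod b \<le> 1" "cmod c \<le> 1" using bin(1,2) by (auto simp: abs_square_le_1)
  show "cmod (a - b * cnj c) \<le> sqrt (1 - (cmod b)\<^sup>2) * sqrt (1 - (cmod c)\<^sup>2)"
    unfolding real_sqrt_mult[symmetric] by (rule real_le_rsqrt) (rule bin(3))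
qed

text \<open>The left side is real-linear in \<open>a\<close>, so over the disc it is largest at
  \<open>b * cnj c + s * t * u\<close>, where \<open>u\<close> is the phase making
  \<open>a' * u\<close> nonnegative. The matrix with that entry averages two unimodular rank-one
  matrices, at which the second form is at most \<open>M\<close>.\<close>

lemma correlation_trace_le:
  fixes a b c a' b' c' :: complex
  assumes nonneg: "\<And>x y z. 0 \<le> hform 1 1 1 a b c x y z"
    and unimod: "\<And>x y z. cmod x = 1 \<Longrightarrow> cmod y = 1 \<Longrightarrow> cmod z = 1 \<Longrightarrow> hform \<alpha> \<beta> \<gamma> a' b' c' x y z \<le> M"
  shows "\<alpha> + \<beta> + \<gamma> + 2 * Re (a' * a + b' * b + c' * c) \<le> M"
proof -
  note disc = hform_nonneg_imp[OF nonneg]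
  define s t where "s = sqrt (1 - (cmod b)\<^sup>2)" and "t = sqrt (1 - (cmod c)\<^sup>2)"
  have s: "s\<^sup>2 = 1 - (cmod b)\<^sup>2" and t: "t\<^sup>2 = 1 - (cmod c)\<^sup>2"
    unfolding s_def t_def using disc(1,2) by (auto simp: abs_square_le_1)
  obtain u where u: "cmod u = 1" "a' * u = of_real (cmod a')" using unimodular_multiple by blast
  obtain \<zeta> \<xi> :: complex and l m :: real where
    1: "cmod (b + s * \<zeta>) = 1" "cmod (c + t * cnj u * \<zeta>) = 1"
      "cmod (b + s * \<xi>) = 1" "cmod (c + t * cnj u * \<xi>) = 1" and
    2: "0 \<le> l" "0 \<le> m" "l + m = 1" and
    3: "l * \<zeta> + m * \<xi> = 0" "l * (cmod \<zeta>)\<^sup>2 + m * (cmod \<xi>)\<^sup>2 = 1"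
    \<comment> \<open>The factor \<open>cnj u\<close> makes the averaged entry 12 equal to the
      extreme point \<open>b * cnj c + s * t * u\<close>.\<close>
    by (rule unimodular_decomposition[of b "of_real s" c "t * cnj u"])
      (auto simp: s t norm_mult power_mult_distrib u)
  define H where "H \<omega> = hform \<alpha> \<beta> \<gamma> a' b' c' (b + s * \<omega>) (c + t * cnj u * \<omega>) 1" for \<omega> :: complex
  have H: "H \<omega> = \<alpha> + \<beta> + \<gamma> + 2 * Re (a' * (b * cnj c) + b' * b + c' * c)
              + 2 * Re ((a' * cnj c * s + b' * s + c' * t * cnj u) * \<omega> + a' * b * t * u * cnj \<omega>)
              + 2 * (cmod a' * s * t) * (cmod \<omega>)\<^sup>2"
    if "cmod (b + s * \<omega>) = 1" "cmod (c + t * cnj u * \<omega>) = 1" for \<omega> :: complex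
  proof -
    have "a' * ((b + s * \<omega>) * cnj (c + t * cnj u * \<omega>)) =
        a' * (b * cnj c) + (a' * cnj c * s) * \<omega> + a' * b * t * u * cnj \<omega>
          + (a' * u) * s * t * (\<omega> * cnj \<omega>)"
      by (simp add: algebra_simps)
    also have "(a' * u) * s * t * (\<omega> * cnj \<omega>) = of_real (cmod a' * s * t * (cmod \<omega>)\<^sup>2)"
      by (simp only: u(2) of_real_mult complex_norm_square mult.assoc)
    finally have E: "a' * ((b + s * \<omega>) * cnj (c + t * cnj u * \<omega>)) =
        a' * (b * cnj c) + (a' * cnj c * s) * \<omega> + a' * b * t * u * cnj \<omega>
          + of_real (cmod a' * s * t * (cmod \<omega>)\<^sup>2)" .
    show ?thesis
      unfolding H_def hform_def that E by (simp add: algebra_simps)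
  qed
  have lin: "l * Re (h * \<zeta> + g * cnj \<zeta>) + m * Re (h * \<xi> + g * cnj \<xi>) = 0" for h g
  proof -
    have "l * Re (h * \<zeta> + g * cnj \<zeta>) + m * Re (h * \<xi> + g * cnj \<xi>)
        = Re (h * (l * \<zeta> + m * \<xi>) + g * cnj (l * \<zeta> + m * \<xi>))"
      by (simp add: algebra_simps)
    then show ?thesis using 3(1) by simp
  qed
  define D where "D = \<alpha> + \<beta> + \<gamma> + 2 * Re (a' * (b * cnj c) + b' * b + c' * c)"
  define L where "L \<omega> = Re ((a' * cnj c * s + b' * s + c' * t * cnj u) * \<omega> + a' * b * t * u * cnj \<omega>)"
    for \<omega> :: complex
  \<comment> \<open>Constant, linear and quadratic parts: they average to \<open>D\<close>, to zero
    and to the extremal gain.\<close>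
  have "l * H \<zeta> + m * H \<xi> = (l + m) * D + 2 * (l * L \<zeta> + m * L \<xi>)
      + 2 * (cmod a' * s * t) * (l * (cmod \<zeta>)\<^sup>2 + m * (cmod \<xi>)\<^sup>2)"
    unfolding H[OF 1(1,2)] H[OF 1(3,4)] D_def[symmetric] L_def[symmetric]
    by (simp only: algebra_simps)
  also have "\<dots> = D + 2 * (cmod a' * s * t)"
    unfolding 2(3) 3(2) L_def lin by simp
  finally have avg: "D + 2 * (cmod a' * s * t) = l * H \<zeta> + m * H \<xi>" ..
  have "H \<zeta> \<le> M" "H \<xi> \<le> M" unfolding H_def using 1 by (auto intro!: unimod)
  then have "l * H \<zeta> + m * H \<xi> \<le> M" using convex_bound_le 2 by blast
  moreover have "Re (a' * (a - b * cnj c)) \<le> cmod a' * s * t"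
  proof -
    have "Re (a' * (a - b * cnj c)) \<le> cmod (a' * (a - b * cnj c))" by (rule complex_Re_le_cmod)
    also have "\<dots> \<le> cmod a' * (s * t)"
      unfolding norm_mult s_def t_def by (intro mult_left_mono disc(3)) simp
    finally show ?thesis by simp
  qed
  ultimately show ?thesis using avg unfolding D_def by (simp add: algebra_simps)
qed

text \<open>Raising the first diagonal to \<open>R\<close> keeps the form nonnegative and does not
  lower the trace, as the second diagonal is nonnegative. Division by \<open>R\<close> then gives
  unit diagonal.\<close>

lemma hform_trace_le:
  fixes a b c a' b' c' :: complex
  assumes nonneg: "\<And>x y z. 0 \<le> hform \<alpha> \<beta> \<gamma> a b c x y z"
    and le: "\<alpha> \<le> R" "\<beta> \<le> R" "\<gamma> \<le> R" and R: "0 < R"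
    and nonneg': "0 \<le> \<alpha>'" "0 \<le> \<beta>'" "0 \<le> \<gamma>'"
    and unimod: "\<And>x y z. cmod x = 1 \<Longrightarrow> cmod y = 1 \<Longrightarrow> cmod z = 1 \<Longrightarrow> hform \<alpha>' \<beta>' \<gamma>' a' b' c' x y z \<le> M"
  shows "\<alpha> * \<alpha>' + \<beta> * \<beta>' + \<gamma> * \<gamma>' + 2 * Re (a * a' + b * b' + c * c') \<le> R * M"
proof -
  have "0 \<le> hform 1 1 1 (a / R) (b / R) (c / R) x y z" for x y z
  proof -
    have "hform \<alpha> \<beta> \<gamma> a b c x y z \<le> hform R R R a b c x y z"
      unfolding hform_def using le[THEN mult_right_mono, OF zero_le_power2[of "cmod _"]]
      by (intro add_mono order_refl) auto
    also have "\<dots> = R * hform 1 1 1 (a / R) (b / R) (c / R) x y z"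
      unfolding hform_def using R by (simp add: field_simps)
    finally have "0 \<le> R * hform 1 1 1 (a / R) (b / R) (c / R) x y z"
      using nonneg order_trans by blast
    with R show ?thesis by (simp add: zero_le_mult_iff)
  qed
  define X where "X = Re (a * a' + b * b' + c * c')"
  from correlation_trace_le[OF \<open>\<And>x y z. 0 \<le> hform 1 1 1 (a / R) (b / R) (c / R) x y z\<close> unimod]
  have "\<alpha>' + \<beta>' + \<gamma>' + 2 * Re (a' * (a / R) + b' * (b / R) + c' * (c / R)) \<le> M" .
  also have "a' * (a / R) + b' * (b / R) + c' * (c / R) = (a * a' + b * b' + c * c') / complex_of_real R"
    by (simp add: add_divide_distrib mult.commute)
  finally have "\<alpha>' + \<beta>' + \<gamma>' + 2 * (Re (a * a' + b * b' + c * c') / R) \<le> M"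
    by (simp only: Re_divide_of_real)
  then have "R * (\<alpha>' + \<beta>' + \<gamma>' + 2 * (X / R)) \<le> R * M"
    unfolding X_def using R by simp
  then have "R * \<alpha>' + R * \<beta>' + R * \<gamma>' + 2 * X \<le> R * M"
    using R by (simp add: distrib_left)
  moreover have "\<alpha> * \<alpha>' \<le> R * \<alpha>'" "\<beta> * \<beta>' \<le> R * \<beta>'" "\<gamma> * \<gamma>' \<le> R * \<gamma>'"
    using le nonneg' by (auto intro: mult_right_mono)
  ultimately show ?thesis unfolding X_def by linarith
qed

section \<open>Gram matrices\<close>

lemma summable_ell2_mult_cnj: "summable (\<lambda>i. ell2_nth x i * cnj (ell2_nth y i))"
proof (rule summable_comparison_test')
  show "summable (\<lambda>i. (cmod (ell2_nth x i))\<^sup>2 + (cmod (ell2_nth y i))\<^sup>2)"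
    using ell2_nth[of x] ell2_nth[of y] by (intro summable_add) auto
  fix i
  have "2 * (p * q) \<le> p\<^sup>2 + q\<^sup>2" for p q :: real
    using sum_squares_bound[of p q] by simp
  moreover have "0 \<le> cmod (ell2_nth x i) * cmod (ell2_nth y i)" by simp
  ultimately show "norm (ell2_nth x i * cnj (ell2_nth y i)) \<le> (cmod (ell2_nth x i))\<^sup>2 + (cmod (ell2_nth y i))\<^sup>2"
    unfolding norm_mult complex_mod_cnj by (smt (verit))
qed

lemma ell2_norm_sums: "(\<lambda>i. (cmod (ell2_nth x i))\<^sup>2) sums (norm x)\<^sup>2"
proof -
  have s: "summable (\<lambda>i. (cmod (ell2_nth x i))\<^sup>2)" using ell2_nth[of x] by simp
  then have "(norm x)\<^sup>2 = (\<Sum>i. (cmod (ell2_nth x i))\<^sup>2)"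
    by (simp add: norm_ell2.rep_eq suminf_nonneg)
  with s show ?thesis by (simp add: summable_sums)
qed

text \<open>The coefficients are the inner products, as series; the identity is summed
  coordinatewise.\<close>

lemma ell2_gram:
  fixes u v w :: ell2
  obtains a b c where
    "\<And>x y z. (norm (x *\<^sub>C u + y *\<^sub>C v + z *\<^sub>C w))\<^sup>2
       = hform ((norm u)\<^sup>2) ((norm v)\<^sup>2) ((norm w)\<^sup>2) a b c x y z"
proof -
  define ip where "ip f g = (\<Sum>i. ell2_nth f i * cnj (ell2_nth g i))" for f g
  have ip: "(\<lambda>i. ell2_nth f i * cnj (ell2_nth g i)) sums ip f g" for f g
    unfolding ip_def by (rule summable_sums[OF summable_ell2_mult_cnj])
  have "(norm (x *\<^sub>C u + y *\<^sub>C v + z *\<^sub>C w))\<^sup>2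
       = hform ((norm u)\<^sup>2) ((norm v)\<^sup>2) ((norm w)\<^sup>2) (ip u v) (ip u w) (ip v w) x y z" for x y z
  proof (rule sums_unique2[OF ell2_norm_sums])
    show "(\<lambda>i. (cmod (ell2_nth (x *\<^sub>C u + y *\<^sub>C v + z *\<^sub>C w) i))\<^sup>2) sums
        hform ((norm u)\<^sup>2) ((norm v)\<^sup>2) ((norm w)\<^sup>2) (ip u v) (ip u w) (ip v w) x y z"
      unfolding plus_ell2.rep_eq scaleC_ell2.rep_eq cmod_power2_linear_combination hform_def
      by (intro sums_add sums_mult sums_mult2 ell2_norm_sums ip sums_Re)
  qed
  then show ?thesis by (rule that)
qed

lemma hform_sum:
  "(\<Sum>i\<in>I. hform (\<alpha> i) (\<beta> i) (\<gamma> i) (a i) (b i) (c i) x y z) =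
     hform (sum \<alpha> I) (sum \<beta> I) (sum \<gamma> I) (sum a I) (sum b I) (sum c I) x y z"
  unfolding hform_def
  by (simp only: sum.distrib sum_distrib_left sum_distrib_right Re_sum plus_complex.sel distrib_left)

text \<open>Summing over arguments gives the trace pairing of the form with the Gram matrix of
  \<open>u\<close>, \<open>v\<close>, \<open>w\<close>.\<close>

lemma sum_hform:
  "(\<Sum>i\<in>I. hform \<alpha> \<beta> \<gamma> a b c (u i) (v i) (w i)) =
     \<alpha> * (\<Sum>i\<in>I. (cmod (u i))\<^sup>2) + \<beta> * (\<Sum>i\<in>I. (cmod (v i))\<^sup>2) + \<gamma> * (\<Sum>i\<in>I. (cmod (w i))\<^sup>2)
       + 2 * Re (a * (\<Sum>i\<in>I. u i * cnj (v i)) + b * (\<Sum>i\<in>I. u i * cnj (w i)) + c * (\<Sum>i\<in>I. v i * cnj (w i)))"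
  unfolding hform_def
  by (simp only: sum.distrib sum_distrib_left sum_distrib_right Re_sum plus_complex.sel distrib_left)

lemma sum_cmod_power2_linear_combination:
  "(\<Sum>i\<in>I. (cmod (x * u i + y * v i + z * w i))\<^sup>2) =
     hform (\<Sum>i\<in>I. (cmod (u i))\<^sup>2) (\<Sum>i\<in>I. (cmod (v i))\<^sup>2) (\<Sum>i\<in>I. (cmod (w i))\<^sup>2)
       (\<Sum>i\<in>I. u i * cnj (v i)) (\<Sum>i\<in>I. u i * cnj (w i)) (\<Sum>i\<in>I. v i * cnj (w i)) x y z"
  unfolding cmod_power2_linear_combination hform_sum ..

text \<open>The trace inequality with the Gram matrix of the \<open>t\<close>s as the one with
  bounded diagonal; this is the order for the 1-norm.\<close>

lemma sum_norm_power2_le_of_unimodular_coeffs: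
  fixes t1 t2 t3 :: ell2
  assumes le: "norm t1 \<le> K" "norm t2 \<le> K" "norm t3 \<le> K"
    and unimod: "\<And>x y z. cmod x = 1 \<Longrightarrow> cmod y = 1 \<Longrightarrow> cmod z = 1 \<Longrightarrow>
           (\<Sum>i\<in>I. (cmod (x * u i + y * v i + z * w i))\<^sup>2) \<le> 1"
  shows "(\<Sum>i\<in>I. (norm (u i *\<^sub>C t1 + v i *\<^sub>C t2 + w i *\<^sub>C t3))\<^sup>2) \<le> K\<^sup>2"
\<comment> \<open>\<open>K\<close> may be 0, while \<open>hform_trace_le\<close> asks for a positive
  diagonal bound.\<close>
proof (rule field_le_epsilon)
  fix \<epsilon> :: real assume \<epsilon>: "0 < \<epsilon>"
  obtain a b c where G: "\<And>x y z. (norm (x *\<^sub>C t1 + y *\<^sub>C t2 + z *\<^sub>C t3))\<^sup>2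
       = hform ((norm t1)\<^sup>2) ((norm t2)\<^sup>2) ((norm t3)\<^sup>2) a b c x y z"
    using ell2_gram by blast
  have le': "(norm t1)\<^sup>2 \<le> K\<^sup>2 + \<epsilon>" "(norm t2)\<^sup>2 \<le> K\<^sup>2 + \<epsilon>" "(norm t3)\<^sup>2 \<le> K\<^sup>2 + \<epsilon>"
    using le[THEN power_mono, of 2] \<epsilon> by auto
  have pos: "0 < K\<^sup>2 + \<epsilon>" using \<epsilon> by (simp add: add_nonneg_pos)
  have nonneg: "0 \<le> hform ((norm t1)\<^sup>2) ((norm t2)\<^sup>2) ((norm t3)\<^sup>2) a b c x y z" for x y z
    unfolding G[symmetric] by simp
  have sums: "0 \<le> (\<Sum>i\<in>I. (cmod (f i))\<^sup>2)" for f by (simp add: sum_nonneg)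
  have "hform (\<Sum>i\<in>I. (cmod (u i))\<^sup>2) (\<Sum>i\<in>I. (cmod (v i))\<^sup>2) (\<Sum>i\<in>I. (cmod (w i))\<^sup>2)
       (\<Sum>i\<in>I. u i * cnj (v i)) (\<Sum>i\<in>I. u i * cnj (w i)) (\<Sum>i\<in>I. v i * cnj (w i)) x y z \<le> 1"
    if "cmod x = 1" "cmod y = 1" "cmod z = 1" for x y z
    using unimod[OF that] by (simp only: sum_cmod_power2_linear_combination)
  note trace = hform_trace_le[OF nonneg le' pos sums[of u] sums[of v] sums[of w] this]
  show "(\<Sum>i\<in>I. (norm (u i *\<^sub>C t1 + v i *\<^sub>C t2 + w i *\<^sub>C t3))\<^sup>2) \<le> K\<^sup>2 + \<epsilon>"
    unfolding G sum_hform by (rule trace[unfolded mult_1_right])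
qed

text \<open>The same inequality with the two Gram matrices exchanged, for the maximum norm.\<close>

lemma sum_norm_power2_le_of_unimodular_vectors:
  fixes t1 t2 t3 :: ell2
  assumes le: "(\<Sum>i\<in>I. (cmod (u i))\<^sup>2) \<le> 1" "(\<Sum>i\<in>I. (cmod (v i))\<^sup>2) \<le> 1" "(\<Sum>i\<in>I. (cmod (w i))\<^sup>2) \<le> 1"
    and unimod: "\<And>x y z. cmod x = 1 \<Longrightarrow> cmod y = 1 \<Longrightarrow> cmod z = 1 \<Longrightarrow>
           norm (x *\<^sub>C t1 + y *\<^sub>C t2 + z *\<^sub>C t3) \<le> K"
  shows "(\<Sum>i\<in>I. (norm (u i *\<^sub>C t1 + v i *\<^sub>C t2 + w i *\<^sub>C t3))\<^sup>2) \<le> K\<^sup>2"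
proof -
  obtain a b c where G: "\<And>x y z. (norm (x *\<^sub>C t1 + y *\<^sub>C t2 + z *\<^sub>C t3))\<^sup>2
       = hform ((norm t1)\<^sup>2) ((norm t2)\<^sup>2) ((norm t3)\<^sup>2) a b c x y z"
    using ell2_gram by blast
  have unimod': "hform ((norm t1)\<^sup>2) ((norm t2)\<^sup>2) ((norm t3)\<^sup>2) a b c x y z \<le> K\<^sup>2"
    if "cmod x = 1" "cmod y = 1" "cmod z = 1" for x y z
    unfolding G[symmetric] by (intro power_mono unimod that norm_ge_zero)
  have nonneg: "0 \<le> hform (\<Sum>i\<in>I. (cmod (u i))\<^sup>2) (\<Sum>i\<in>I. (cmod (v i))\<^sup>2) (\<Sum>i\<in>I. (cmod (w i))\<^sup>2)
       (\<Sum>i\<in>I. u i * cnj (v i)) (\<Sum>i\<in>I. u i * cnj (w i)) (\<Sum>i\<in>I. v i * cnj (w i)) x y z" for x y z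
    unfolding sum_cmod_power2_linear_combination[symmetric] by (simp add: sum_nonneg)
  note trace = hform_trace_le[OF nonneg le zero_less_one zero_le_power2 zero_le_power2 zero_le_power2 unimod']
  show ?thesis
    unfolding G sum_hform mult.commute[of "(norm _)\<^sup>2"] mult.commute[of a] mult.commute[of b] mult.commute[of c]
    by (rule trace[unfolded mult_1_left])
qed

section \<open>Operators on \<open>\<ell>\<^sub>2\<^sup>n\<close> and the \<open>2\<close>-summing property\<close>

lemma ell2_fin_contraction_expand:
  fixes \<phi> :: "'a::complex_normed_vector \<Rightarrow> complex"
  assumes U: "ell2_fin_contraction n U" and x: "x \<in> ell2_fin_carrier n"
    and \<phi>: "\<And>v w. \<phi> (v + w) = \<phi> v + \<phi> w" "\<And>k v. \<phi> (k *\<^sub>C v) = k * \<phi> v"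
  shows "\<phi> (U x) = (\<Sum>i<n. x i * \<phi> (U (ell2_fin_unit i)))"
proof -
  have add: "U (\<lambda>i. f i + g i) = U f + U g"
    if "f \<in> ell2_fin_carrier n" "g \<in> ell2_fin_carrier n" for f g
    using U that unfolding ell2_fin_contraction_def by blast
  have scale: "U (\<lambda>i. k * f i) = k *\<^sub>C U f" if "f \<in> ell2_fin_carrier n" for k f
    using U that unfolding ell2_fin_contraction_def by blast
  \<comment> \<open>Induction over truncations of \<open>x\<close>, which stay in the carrier, where
    \<open>U\<close> is linear.\<close>
  have "\<phi> (U (\<lambda>i. if i < m then x i else 0)) = (\<Sum>i<m. x i * \<phi> (U (ell2_fin_unit i)))" if "m \<le> n" for m
    using that
  proof (induction m)
    case 0
    have "U (\<lambda>i. 0 * (0 :: complex)) = 0 *\<^sub>C U (\<lambda>i. 0)"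
      by (rule scale) (simp add: ell2_fin_carrier_def)
    then have "\<phi> (U (\<lambda>i. 0)) = 0 * \<phi> (U (\<lambda>i. 0))" by (metis mult_zero_left \<phi>(2))
    then show ?case by simp
  next
    case (Suc m)
    have e: "ell2_fin_unit m \<in> ell2_fin_carrier n"
      using Suc.prems by (simp add: ell2_fin_carrier_def ell2_fin_unit_def)
    have *: "(\<lambda>i. if i < Suc m then x i else 0)
        = (\<lambda>i. (if i < m then x i else 0) + x m * ell2_fin_unit m i)"
      by (auto simp: fun_eq_iff ell2_fin_unit_def less_Suc_eq)
    have "U (\<lambda>i. if i < Suc m then x i else 0) = U (\<lambda>i. if i < m then x i else 0) + U (\<lambda>i. x m * ell2_fin_unit m i)"
      unfolding * by (rule add) (use Suc.prems e in \<open>auto simp: ell2_fin_carrier_def\<close>)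
    also have "U (\<lambda>i. x m * ell2_fin_unit m i) = x m *\<^sub>C U (ell2_fin_unit m)"
      by (rule scale[OF e])
    finally show ?case using Suc by (simp add: \<phi>)
  qed
  moreover have "(\<lambda>i. if i < n then x i else 0) = x"
    using x by (auto simp: ell2_fin_carrier_def fun_eq_iff)
  ultimately show ?thesis by (metis order_refl)
qed

text \<open>Testing the contraction on the conjugated coefficients of the functional \<open>\<phi> \<circ> U\<close>.\<close>

lemma ell2_fin_contraction_functional:
  fixes \<phi> :: "'a::complex_normed_vector \<Rightarrow> complex"
  assumes U: "ell2_fin_contraction n U"
    and \<phi>: "\<And>v w. \<phi> (v + w) = \<phi> v + \<phi> w" "\<And>k v. \<phi> (k *\<^sub>C v) = k * \<phi> v"
    and le: "\<And>v. cmod (\<phi> v) \<le> norm v"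
  shows "(\<Sum>i<n. (cmod (\<phi> (U (ell2_fin_unit i))))\<^sup>2) \<le> 1"
proof -
  define x where "x i = (if i < n then cnj (\<phi> (U (ell2_fin_unit i))) else 0)" for i
  define S where "S = (\<Sum>i<n. (cmod (\<phi> (U (ell2_fin_unit i))))\<^sup>2)"
  have x: "x \<in> ell2_fin_carrier n" by (simp add: x_def ell2_fin_carrier_def)
  have S0: "0 \<le> S" by (simp add: S_def sum_nonneg)
  have "\<phi> (U x) = (\<Sum>i<n. of_real ((cmod (\<phi> (U (ell2_fin_unit i))))\<^sup>2))"
    unfolding ell2_fin_contraction_expand[of n U x \<phi>, OF U x \<phi>] x_def complex_norm_square
    by (simp add: mult.commute)
  then have "\<phi> (U x) = of_real S" by (simp add: S_def)
  then have "S = cmod (\<phi> (U x))" using S0 by simp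
  also have "\<dots> \<le> norm (U x)" by (rule le)
  also have "\<dots> \<le> L2_set (\<lambda>i. cmod (x i)) {..<n}"
    using U x unfolding ell2_fin_contraction_def by blast
  also have "\<dots> = sqrt S" by (simp add: L2_set_def x_def S_def)
  finally have "S \<le> sqrt S" .
  then have "S\<^sup>2 \<le> (sqrt S)\<^sup>2" using S0 by (intro power_mono)
  then have "S * S \<le> S" using S0 by (simp add: power2_eq_square)
  then show ?thesis unfolding S_def[symmetric] using S0
    by (metis mult.right_neutral mult_le_cancel_left_pos nle_le not_one_le_zero order_le_less)
qed

text \<open>Only the upper bound depends on the space: operators from the one-dimensional Hilbert
  space already give \<open>onorm T\<close> as a lower bound.\<close>

lemma two_summing_propertyI:
  assumes "\<And>(T :: 'a::complex_banach \<Rightarrow> ell2) n U. bounded_clinear T \<Longrightarrow> ell2_fin_contraction n U \<Longrightarrow>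
     (\<Sum>i<n. (norm (T (U (ell2_fin_unit i))))\<^sup>2) \<le> (onorm T)\<^sup>2"
  shows "two_summing_property TYPE('a)"
  unfolding two_summing_property_def
proof (intro allI impI)
  fix T :: "'a \<Rightarrow> ell2" assume T: "bounded_clinear T"
  then have bl: "bounded_linear T" by (simp add: bounded_clinear_def)
  have K: "0 \<le> onorm T" by (rule onorm_pos_le[OF bl])
  have upper: "two_summing_norm T \<le> ennreal (onorm T)"
    unfolding two_summing_norm_def
  proof (rule SUP_least, clarify)
    fix n and U :: "(nat \<Rightarrow> complex) \<Rightarrow> 'a"
    assume "ell2_fin_contraction n U"
    from assms[OF T this] K
    show "ennreal (sqrt (\<Sum>i<n. (norm (T (U (ell2_fin_unit i))))\<^sup>2)) \<le> ennreal (onorm T)"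
      by (intro ennreal_leI real_le_lsqrt) (auto simp: sum_nonneg)
  qed
  \<comment> \<open>The upper bound makes the supremum finite, so it can serve as a real bound for
    \<open>onorm T\<close>.\<close>
  obtain r where r: "0 \<le> r" "two_summing_norm T = ennreal r"
    using upper by (metis ennreal_cases ennreal_neq_top neq_top_trans)
  have unit: "norm (T v) \<le> r" if v: "norm v \<le> 1" for v
  proof -
    define U where "U x = x 0 *\<^sub>C v" for x :: "nat \<Rightarrow> complex"
    have "ell2_fin_contraction 1 U"
      unfolding ell2_fin_contraction_def U_def
      using v by (auto simp: scaleC_add_left scaleC_scaleC norm_scaleC L2_set_def mult_left_le)
    then have "ennreal (sqrt (\<Sum>i<1. (norm (T (U (ell2_fin_unit i))))\<^sup>2)) \<le> two_summing_norm T"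
      unfolding two_summing_norm_def by (intro SUP_upper2[of "(1, U)"]) auto
    moreover have "U (ell2_fin_unit 0) = v"
      using scaleR_scaleC[of 1 v] by (simp add: U_def ell2_fin_unit_def)
    ultimately show ?thesis using r by (simp add: ennreal_le_iff)
  qed
  have "onorm T \<le> r"
  proof (rule onorm_bound[OF r(1)])
    fix x
    interpret bounded_linear T by (rule bl)
    show "norm (T x) \<le> r * norm x"
    proof (cases "x = 0")
      case False
      have "norm (T (inverse (norm x) *\<^sub>R x)) \<le> r" by (rule unit) (use False in simp)
      with False show ?thesis by (simp add: scaleR field_simps)
    qed (simp add: zero)
  qed
  then have "ennreal (onorm T) \<le> two_summing_norm T" using r by (simp add: ennreal_leI)
  with upper show "two_summing_norm T = ennreal (onorm T)" by (rule antisym)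
qed

section \<open>The two three-dimensional spaces\<close>

lemma bounded_clinear_combination:
  assumes "bounded_clinear T"
  shows "T (x *\<^sub>C u + y *\<^sub>C v + z *\<^sub>C w) = x *\<^sub>C T u + y *\<^sub>C T v + z *\<^sub>C T w"
proof -
  interpret bounded_linear T using assms by (simp add: bounded_clinear_def)
  show ?thesis using assms by (simp add: add bounded_clinear_def)
qed

lemma norm_bounded_clinear_le:
  assumes "bounded_clinear T" "norm v \<le> 1"
  shows "norm (T v) \<le> onorm T"
proof -
  have bl: "bounded_linear T" using assms(1) by (simp add: bounded_clinear_def)
  have "norm (T v) \<le> onorm T * norm v" by (rule onorm[OF bl])
  also have "\<dots> \<le> onorm T" using assms(2) onorm_pos_le[OF bl] by (simp add: mult_left_le)
  finally show ?thesis .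
qed

text \<open>The unit vectors have norm 1, which bounds the diagonal of the Gram matrix of
  \<open>T\<close>; unimodular coefficients define functionals of norm at most 1, which bound the
  form of \<open>U\<close>.\<close>

lemma two_summing_ell1_3: "two_summing_property TYPE(3 ell1_fin)"
proof (rule two_summing_propertyI)
  fix T :: "3 ell1_fin \<Rightarrow> ell2" and n and U :: "(nat \<Rightarrow> complex) \<Rightarrow> 3 ell1_fin"
  assume T: "bounded_clinear T" and U: "ell2_fin_contraction n U"
  define e where "e j = Abs_ell1_fin (axis j 1)" for j :: 3
  define u where "u j i = ell1_vec (U (ell2_fin_unit i)) $ j" for j i
  have expand: "v = (ell1_vec v $ 1) *\<^sub>C e 1 + (ell1_vec v $ 2) *\<^sub>C e 2 + (ell1_vec v $ 3) *\<^sub>C e 3" for v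
    unfolding e_def ell1_vec_inject[symmetric] plus_ell1_fin.rep_eq scaleC_ell1_fin.rep_eq
    by (simp add: Abs_ell1_fin_inverse vec_eq_iff forall_3 axis_def)
  have TU: "T (U (ell2_fin_unit i)) = u 1 i *\<^sub>C T (e 1) + u 2 i *\<^sub>C T (e 2) + u 3 i *\<^sub>C T (e 3)" for i
    unfolding u_def bounded_clinear_combination[OF T, symmetric] expand[symmetric] ..
  have e: "norm (T (e j)) \<le> onorm T" for j
    by (rule norm_bounded_clinear_le[OF T])
      (simp add: e_def norm_ell1_fin.rep_eq Abs_ell1_fin_inverse axis_def if_distrib cong: if_cong)
  show "(\<Sum>i<n. (norm (T (U (ell2_fin_unit i))))\<^sup>2) \<le> (onorm T)\<^sup>2"
    unfolding TU
  proof (rule sum_norm_power2_le_of_unimodular_coeffs[OF e e e])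
    fix x y z :: complex
    assume 1: "cmod x = 1" "cmod y = 1" "cmod z = 1"
    define \<phi> where "\<phi> v = x * ell1_vec v $ 1 + y * ell1_vec v $ 2 + z * ell1_vec v $ 3" for v :: "3 ell1_fin"
    have "cmod (\<phi> v) \<le> norm v" for v
    proof -
      have "cmod (\<phi> v) \<le> cmod (x * ell1_vec v $ 1) + cmod (y * ell1_vec v $ 2) + cmod (z * ell1_vec v $ 3)"
        unfolding \<phi>_def by (meson norm_triangle_ineq norm_triangle_mono order_refl)
      then show ?thesis by (simp add: norm_mult 1 norm_ell1_fin.rep_eq sum_3)
    qed
    then have "(\<Sum>i<n. (cmod (\<phi> (U (ell2_fin_unit i))))\<^sup>2) \<le> 1"
      by (intro ell2_fin_contraction_functional[OF U])
        (simp_all add: \<phi>_def plus_ell1_fin.rep_eq scaleC_ell1_fin.rep_eq algebra_simps)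
    then show "(\<Sum>i<n. (cmod (x * u 1 i + y * u 2 i + z * u 3 i))\<^sup>2) \<le> 1"
      by (simp add: \<phi>_def u_def)
  qed
qed

text \<open>Dually, coordinate functionals of norm at most 1 bound the diagonal of the Gram matrix
  of \<open>U\<close>, and unimodular vectors lie in the unit ball, which bounds the form of
  \<open>T\<close>.\<close>

lemma two_summing_ellinf_3: "two_summing_property TYPE(3 ellinf_fin)"
proof (rule two_summing_propertyI)
  fix T :: "3 ellinf_fin \<Rightarrow> ell2" and n and U :: "(nat \<Rightarrow> complex) \<Rightarrow> 3 ellinf_fin"
  assume T: "bounded_clinear T" and U: "ell2_fin_contraction n U"
  define e where "e j = Abs_ellinf_fin (axis j 1)" for j :: 3
  define u where "u j i = ellinf_vec (U (ell2_fin_unit i)) $ j" for j i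
  have expand: "v = (ellinf_vec v $ 1) *\<^sub>C e 1 + (ellinf_vec v $ 2) *\<^sub>C e 2 + (ellinf_vec v $ 3) *\<^sub>C e 3" for v
    unfolding e_def ellinf_vec_inject[symmetric] plus_ellinf_fin.rep_eq scaleC_ellinf_fin.rep_eq
    by (simp add: Abs_ellinf_fin_inverse vec_eq_iff forall_3 axis_def)
  have TU: "T (U (ell2_fin_unit i)) = u 1 i *\<^sub>C T (e 1) + u 2 i *\<^sub>C T (e 2) + u 3 i *\<^sub>C T (e 3)" for i
    unfolding u_def bounded_clinear_combination[OF T, symmetric] expand[symmetric] ..
  have u: "(\<Sum>i<n. (cmod (u j i))\<^sup>2) \<le> 1" for j
    unfolding u_def
    by (rule ell2_fin_contraction_functional[OF U, of "\<lambda>v. ellinf_vec v $ j"])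
      (simp_all add: plus_ellinf_fin.rep_eq scaleC_ellinf_fin.rep_eq norm_ellinf_fin.rep_eq)
  show "(\<Sum>i<n. (norm (T (U (ell2_fin_unit i))))\<^sup>2) \<le> (onorm T)\<^sup>2"
    unfolding TU
  proof (rule sum_norm_power2_le_of_unimodular_vectors[OF u u u])
    fix x y z :: complex
    assume 1: "cmod x = 1" "cmod y = 1" "cmod z = 1"
    have "cmod (ellinf_vec (x *\<^sub>C e 1 + y *\<^sub>C e 2 + z *\<^sub>C e 3) $ j) \<le> 1" for j
      using 1 exhaust_3[of j]
      by (auto simp: e_def plus_ellinf_fin.rep_eq scaleC_ellinf_fin.rep_eq Abs_ellinf_fin_inverse axis_def)
    then have "norm (x *\<^sub>C e 1 + y *\<^sub>C e 2 + z *\<^sub>C e 3) \<le> 1"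
      unfolding norm_ellinf_fin.rep_eq Max_cmod_le_iff by blast
    from norm_bounded_clinear_le[OF T this]
    show "norm (x *\<^sub>C T (e 1) + y *\<^sub>C T (e 2) + z *\<^sub>C T (e 3)) \<le> onorm T"
      by (simp only: bounded_clinear_combination[OF T])
  qed
qed

theorem theorem4p2:
  shows "two_summing_property TYPE(3 ell1_fin) \<and> two_summing_property TYPE(3 ellinf_fin)"
  using two_summing_ell1_3 two_summing_ellinf_3 by blast

end
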